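(* Let $G$ be a group, $x\in G$, $n:=o(x)>2$, and let $\alpha\in\{1+x+x^{-1},\,1+x+x^2\}\subset\mathbb{F}_2[G]$. Suppose that $\alpha\beta=0$ for some non-zero $\beta\in\mathbb{F}_2[G]$, where $1\in supp(\beta)$ and $|supp(\beta)|$ is minimum among all non-zero elements of $\mathbb{F}_2[G]$ with the property $\alpha\beta=0$. Let $k:=|supp(\beta)|-1$. Then $\beta=\beta'$ or $\beta=\beta'x^{-1}$, where $\beta':=\sum_{i=0}^{k}x^{s_i}$ with $s_0=0$, $s_1=1$ and $s_i=s_{i-2}+3$ for all $i\in\{2,3,\dots,k\}$.
   Context: $\mathbb{F}_2$ is the field with two elements. The support of $\alpha=\sum_{g\in G}\alpha_g g\in \mathbb{F}_2[G]$ is $supp(\alpha)=\{g\in G : \alpha_g\neq 0\}$. $o(x)$ denotes the order of $x$, a priori allowed to be infinite. *)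

theory Defs
  imports
    "HOL-Algebra.Multiplicative_Group"
    "HOL-Library.Poly_Mapping"
    "HOL-Library.Z2"
    "HOL-Library.Extended_Nat"
begin

text \<open>
  The group algebra \<open>R[G]\<close> of a group given by its carrier.  Its elements are the finitely
  supported functions \<open>'g \<Rightarrow>\<^sub>0 'r\<close> whose support (\<open>keys\<close>) lies in the carrier.  The library's
  product on \<open>'g \<Rightarrow>\<^sub>0 'r\<close> is the convolution for a type class with additively written operation;
  \<open>conv G\<close> is the same convolution for the operation of \<open>G\<close>
  (see \<open>conv_eq_times\<close> below).
\<close>

abbreviation supp :: "('g \<Rightarrow>\<^sub>0 'r::zero) \<Rightarrow> 'g set" where
  "supp \<equiv> Poly_Mapping.keys"

definition conv :: "('g, 'm) monoid_scheme \<Rightarrow> ('g \<Rightarrow>\<^sub>0 'r::ring_1) \<Rightarrow> ('g \<Rightarrow>\<^sub>0 'r) \<Rightarrow> ('g \<Rightarrow>\<^sub>0 'r)" where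
  "conv G p q =
     (\<Sum>a\<in>supp p. \<Sum>b\<in>supp q. Poly_Mapping.single (a \<otimes>\<^bsub>G\<^esub> b)
       (Poly_Mapping.lookup p a * Poly_Mapping.lookup q b))"

definition group_algebra :: "('g, 'm) monoid_scheme \<Rightarrow> ('g \<Rightarrow>\<^sub>0 'r::ring_1) ring" where
  "group_algebra G =
     \<lparr> carrier = {p. supp p \<subseteq> carrier G},
       mult = conv G,
       one = Poly_Mapping.single \<one>\<^bsub>G\<^esub> 1,
       zero = 0,
       add = (+) \<rparr>"

abbreviation F2_algebra :: "('g, 'm) monoid_scheme \<Rightarrow> ('g \<Rightarrow>\<^sub>0 bit) ring" where
  "F2_algebra G \<equiv> group_algebra G"

text \<open>The group element \<open>g\<close> seen as an element of \<open>R[G]\<close>.\<close>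

abbreviation emb :: "'g \<Rightarrow> ('g \<Rightarrow>\<^sub>0 'r::ring_1)" where
  "emb g \<equiv> Poly_Mapping.single g 1"

text \<open>\<^const>\<open>group.ord\<close> is \<open>0\<close> for elements of infinite order.\<close>

definition elt_order :: "('g, 'm) monoid_scheme \<Rightarrow> 'g \<Rightarrow> enat" where
  "elt_order G x = (if group.ord G x = 0 then \<infinity> else enat (group.ord G x))"


lemma group_algebra_simps [simp]:
  "carrier (group_algebra G) = {p. supp p \<subseteq> carrier G}"
  "mult (group_algebra G) = conv G"
  "one (group_algebra G) = emb \<one>\<^bsub>G\<^esub>"
  "zero (group_algebra G) = 0"
  "add (group_algebra G) = (+)"
  by (simp_all add: group_algebra_def)

lemma conv_superset:
  assumes "finite A" "finite B" "supp p \<subseteq> A" "supp q \<subseteq> B"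
  shows "conv G p q =
    (\<Sum>a\<in>A. \<Sum>b\<in>B. Poly_Mapping.single (a \<otimes>\<^bsub>G\<^esub> b)
       (Poly_Mapping.lookup p a * Poly_Mapping.lookup q b))"
proof -
  have "(\<Sum>b\<in>supp q. Poly_Mapping.single (a \<otimes>\<^bsub>G\<^esub> b)
       (Poly_Mapping.lookup p a * Poly_Mapping.lookup q b)) =
        (\<Sum>b\<in>B. Poly_Mapping.single (a \<otimes>\<^bsub>G\<^esub> b)
       (Poly_Mapping.lookup p a * Poly_Mapping.lookup q b))" for a
    by (rule sum.mono_neutral_left) (use assms in \<open>auto simp: in_keys_iff\<close>)
  then show ?thesis
    unfolding conv_def
    by (simp, intro sum.mono_neutral_left) (use assms in \<open>auto simp: in_keys_iff\<close>)
qed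

lemma conv_single:
  "conv G (Poly_Mapping.single a r) (Poly_Mapping.single b s) =
    Poly_Mapping.single (a \<otimes>\<^bsub>G\<^esub> b) (r * s)"
  by (subst conv_superset[of "{a}" "{b}"]) auto

lemma conv_add_left: "conv G (p + q) u = conv G p u + conv G q u"
  using keys_add[of p q]
  by (simp add: conv_superset[of "supp p \<union> supp q" "supp u"]
      lookup_add distrib_right single_add sum.distrib)

lemma conv_add_right: "conv G u (p + q) = conv G u p + conv G u q"
  using keys_add[of p q]
  by (simp add: conv_superset[of "supp u" "supp p \<union> supp q"]
      lookup_add distrib_left single_add sum.distrib)

lemma conv_zero [simp]: "conv G 0 p = 0" "conv G p 0 = 0"
  by (simp_all add: conv_def)

lemma supp_sum_subset:
  assumes "\<And>a. a \<in> A \<Longrightarrow> supp (f a) \<subseteq> C"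
  shows "supp (\<Sum>a\<in>A. f a) \<subseteq> C"
  using assms
proof (induction A rule: infinite_finite_induct)
  case (insert a A)
  then show ?case
    using keys_add[of "f a" "sum f A"] by auto
qed auto

lemma supp_add_subset:
  assumes "supp p \<subseteq> C" "supp q \<subseteq> C"
  shows "supp (p + q) \<subseteq> C"
  using keys_add[of p q] assms by blast

lemma supp_conv:
  assumes "group G" "supp p \<subseteq> carrier G" "supp q \<subseteq> carrier G"
  shows "supp (conv G p q) \<subseteq> carrier G"
proof -
  interpret group G by fact
  show ?thesis
    unfolding conv_def
    by (intro supp_sum_subset) (use assms in auto)
qed

lemma supported_induct [consumes 1, case_names zero single_add]:
  fixes p :: "'g \<Rightarrow>\<^sub>0 'r::comm_monoid_add"
  assumes "supp p \<subseteq> C" "P 0"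
    and "\<And>a r p. a \<in> C \<Longrightarrow> supp p \<subseteq> C \<Longrightarrow> P p \<Longrightarrow> P (Poly_Mapping.single a r + p)"
  shows "P p"
proof -
  have decomp: "p = (\<Sum>a\<in>supp p. Poly_Mapping.single a (Poly_Mapping.lookup p a))"
    by (rule poly_mapping_eqI) (simp add: lookup_sum lookup_single when_def in_keys_iff)
  have "P (\<Sum>a\<in>A. Poly_Mapping.single a (Poly_Mapping.lookup p a)) \<and>
        supp (\<Sum>a\<in>A. Poly_Mapping.single a (Poly_Mapping.lookup p a)) \<subseteq> C"
    if "finite A" "A \<subseteq> C" for A
    using that
  proof (induction A rule: finite_induct)
    case (insert a A)
    let ?q = "\<Sum>a\<in>A. Poly_Mapping.single a (Poly_Mapping.lookup p a)"
    have "supp (Poly_Mapping.single a (Poly_Mapping.lookup p a) + ?q) \<subseteq> C"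
      using insert keys_add[of "Poly_Mapping.single a (Poly_Mapping.lookup p a)" ?q]
      by (auto split: if_splits)
    then show ?case
      using insert assms(3) by simp
  qed (use assms in auto)
  then show ?thesis
    using decomp assms(1) by (metis finite_keys)
qed

lemma conv_assoc:
  assumes "group G" "supp p \<subseteq> carrier G" "supp q \<subseteq> carrier G" "supp u \<subseteq> carrier G"
  shows "conv G (conv G p q) u = conv G p (conv G q u)"
  using assms(2)
proof (induction p rule: supported_induct)
  case (single_add a r p)
  have "conv G (conv G (Poly_Mapping.single a r) q) u =
        conv G (Poly_Mapping.single a r) (conv G q u)"
    using assms(3)
  proof (induction q rule: supported_induct)
    case (single_add b s q)
    have "conv G (conv G (Poly_Mapping.single a r) (Poly_Mapping.single b s)) u =
          conv G (Poly_Mapping.single a r) (conv G (Poly_Mapping.single b s) u)"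
      using assms(4)
    proof (induction u rule: supported_induct)
      case (single_add c t u)
      then show ?case
        using \<open>a \<in> carrier G\<close> \<open>b \<in> carrier G\<close> group.is_monoid[OF assms(1)]
        by (simp add: conv_single conv_add_right monoid.m_assoc mult.assoc)
    qed simp
    with single_add show ?case by (simp add: conv_add_left conv_add_right)
  qed simp
  with single_add show ?case by (simp add: conv_add_left)
qed simp

lemma conv_one:
  assumes "group G" "supp p \<subseteq> carrier G"
  shows "conv G (emb \<one>\<^bsub>G\<^esub>) p = p" "conv G p (emb \<one>\<^bsub>G\<^esub>) = p"
proof -
  interpret group G by fact
  from assms(2) show "conv G (emb \<one>\<^bsub>G\<^esub>) p = p"
    by (induction p rule: supported_induct) (simp_all add: conv_single conv_add_right)
  from assms(2) show "conv G p (emb \<one>\<^bsub>G\<^esub>) = p"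
    by (induction p rule: supported_induct) (simp_all add: conv_single conv_add_left)
qed

lemma ring_group_algebra:
  assumes "group G"
  shows "ring (group_algebra G :: ('g \<Rightarrow>\<^sub>0 'r::ring_1) ring)"
proof -
  interpret group G by fact
  show ?thesis
  proof (rule ringI)
    show "abelian_group (group_algebra G :: ('g \<Rightarrow>\<^sub>0 'r) ring)"
    proof (rule abelian_groupI)
      fix p assume "p \<in> carrier (group_algebra G :: ('g \<Rightarrow>\<^sub>0 'r) ring)"
      then show "\<exists>q\<in>carrier (group_algebra G). q \<oplus>\<^bsub>group_algebra G\<^esub> p = \<zero>\<^bsub>group_algebra G\<^esub>"
        by (intro bexI[of _ "- p"]) auto
    qed (auto simp: add_ac dest: supp_add_subset[THEN subsetD, rotated -1])
    show "monoid (group_algebra G :: ('g \<Rightarrow>\<^sub>0 'r) ring)"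
      by (rule monoidI)
        (use assms in \<open>auto simp: conv_assoc conv_one dest: supp_conv[THEN subsetD, rotated -1]\<close>)
  qed (simp_all add: conv_add_left conv_add_right)
qed

lemma conv_eq_times:
  fixes p q :: "'g::group_add \<Rightarrow>\<^sub>0 'r::ring_1"
  shows "conv \<lparr>carrier = UNIV, mult = (+), one = 0\<rparr> p q = p * q"
proof -
  let ?G = "\<lparr>carrier = UNIV, mult = (+), one = 0\<rparr> :: 'g monoid"
  have *: "supp u \<subseteq> UNIV" for u :: "'g \<Rightarrow>\<^sub>0 'r" by simp
  from *[of p] show ?thesis
  proof (induction p rule: supported_induct)
    case (single_add a r p)
    have "conv ?G (Poly_Mapping.single a r) q = Poly_Mapping.single a r * q"
      using *[of q]
      by (induction q rule: supported_induct)
        (simp_all add: conv_single conv_add_right mult_single distrib_left)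
    with single_add show ?case by (simp add: conv_add_left distrib_right)
  qed simp
qed

end

theory Submission
  imports Defs
begin

text \<open>
  Since \<open>1 + x + x\<^sup>2 = x (1 + x + x\<^sup>-\<^sup>1)\<close>, both choices of \<open>\<alpha>\<close> have the same right annihilator:
  \<open>\<alpha> \<beta> = 0\<close> says that \<open>\<beta>(g) + \<beta>(x g) + \<beta>(x\<^sup>2 g) = 0\<close> for all \<open>g\<close>
  (one direction is \<open>annihilated_by_trinomial\<close>).  Read along the powers of \<open>x\<close>, this is the
  Fibonacci recurrence over the field with two elements, whose solutions have period \<open>3\<close>
  (\<open>bit_fibonacci_pattern\<close>).  As \<open>\<beta>(1) = 1\<close>, the coefficients \<open>\<beta>(x\<^sup>i)\<close> repeat the pattern \<open>1,1,0\<close> or the pattern \<open>1,0,1\<close>.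

  A finite support forces the order \<open>n\<close> of \<open>x\<close> to be finite, and as the sequence \<open>\<beta>(x\<^sup>i)\<close> has
  period \<open>n\<close> but not period \<open>1\<close>, \<open>3\<close> divides \<open>n\<close> (\<open>period_of_mod3_pattern\<close>).  Minimality
  puts the support of \<open>\<beta>\<close> inside the cyclic group generated by \<open>x\<close>, because cutting \<open>\<beta>\<close> down to a subgroup containing the support of
  \<open>\<alpha>\<close> preserves \<open>\<alpha> \<beta> = 0\<close> (\<open>conv_restrict_eq_0\<close>, \<open>minimal_annihilated_supp_subset\<close>).  Therefore
  \<open>|supp \<beta>| = 2 n / 3\<close>, so that \<open>s\<^sub>0, \<dots>, s\<^sub>k\<close> enumerate exactly the exponents below \<open>n\<close> that are
  \<open>0\<close> or \<open>1\<close> modulo \<open>3\<close>: \<open>\<beta>'\<close> is the solution with pattern \<open>1,1,0\<close>, and \<open>\<beta>' x\<^sup>-\<^sup>1\<close> is the one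
  with pattern \<open>1,0,1\<close>.
\<close>

section \<open>Coefficients and sums in the group algebra\<close>

lemma lookup_conv:
  assumes "group G" "supp p \<subseteq> carrier G" "supp q \<subseteq> carrier G" "g \<in> carrier G"
  shows "Poly_Mapping.lookup (conv G p q) g =
    (\<Sum>a\<in>supp p. Poly_Mapping.lookup p a * Poly_Mapping.lookup q (inv\<^bsub>G\<^esub> a \<otimes>\<^bsub>G\<^esub> g))"
proof -
  interpret group G by fact
  have "(\<Sum>b\<in>supp q. Poly_Mapping.lookup p a * Poly_Mapping.lookup q b when a \<otimes>\<^bsub>G\<^esub> b = g) =
      Poly_Mapping.lookup p a * Poly_Mapping.lookup q (inv\<^bsub>G\<^esub> a \<otimes>\<^bsub>G\<^esub> g)"
    if "a \<in> supp p" for a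
  proof -
    have a: "a \<in> carrier G" using that assms by auto
    have "(\<Sum>b\<in>supp q. Poly_Mapping.lookup p a * Poly_Mapping.lookup q b when a \<otimes>\<^bsub>G\<^esub> b = g) =
      (\<Sum>b\<in>supp q. if inv\<^bsub>G\<^esub> a \<otimes>\<^bsub>G\<^esub> g = b
        then Poly_Mapping.lookup p a * Poly_Mapping.lookup q b else 0)"
    proof (rule sum.cong[OF refl])
      fix b assume "b \<in> supp q"
      then have b: "b \<in> carrier G" using assms by auto
      have "a \<otimes>\<^bsub>G\<^esub> b = g \<longleftrightarrow> inv\<^bsub>G\<^esub> a \<otimes>\<^bsub>G\<^esub> g = b"
        using inv_solve_left[of b a g] a b assms by auto
      then show "(Poly_Mapping.lookup p a * Poly_Mapping.lookup q b when a \<otimes>\<^bsub>G\<^esub> b = g) =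
        (if inv\<^bsub>G\<^esub> a \<otimes>\<^bsub>G\<^esub> g = b then Poly_Mapping.lookup p a * Poly_Mapping.lookup q b else 0)"
        by (simp add: when_def)
    qed
    also have "\<dots> = Poly_Mapping.lookup p a * Poly_Mapping.lookup q (inv\<^bsub>G\<^esub> a \<otimes>\<^bsub>G\<^esub> g)"
      by (simp add: in_keys_iff)
    finally show ?thesis .
  qed
  then show ?thesis
    by (simp add: conv_def lookup_sum lookup_single)
qed

lemma lookup_conv_emb_left:
  assumes "group G" "a \<in> carrier G" "supp q \<subseteq> carrier G" "g \<in> carrier G"
  shows "Poly_Mapping.lookup (conv G (emb a) q) g = Poly_Mapping.lookup q (inv\<^bsub>G\<^esub> a \<otimes>\<^bsub>G\<^esub> g)"
  using assms by (simp add: lookup_conv)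

lemma supp_conv_emb_right:
  assumes "group G" "supp p \<subseteq> carrier G" "a \<in> carrier G"
  shows "supp (conv G p (emb a)) = (\<lambda>g. g \<otimes>\<^bsub>G\<^esub> a) ` supp p"
proof -
  interpret group G by fact
  have lookup: "Poly_Mapping.lookup (conv G p (emb a)) g =
      (\<Sum>b\<in>supp p. Poly_Mapping.lookup p b when b \<otimes>\<^bsub>G\<^esub> a = g)" for g
    by (simp add: conv_def lookup_sum lookup_single)
  have "Poly_Mapping.lookup (conv G p (emb a)) (b \<otimes>\<^bsub>G\<^esub> a) = Poly_Mapping.lookup p b"
    if "b \<in> supp p" for b
  proof -
    have "Poly_Mapping.lookup (conv G p (emb a)) (b \<otimes>\<^bsub>G\<^esub> a) =
        (\<Sum>h\<in>supp p. if h = b then Poly_Mapping.lookup p h else 0)"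
      unfolding lookup using assms(2,3) that
      by (intro sum.cong) (auto simp: when_def subset_iff)
    then show ?thesis using that by simp
  qed
  then have "(\<lambda>g. g \<otimes>\<^bsub>G\<^esub> a) ` supp p \<subseteq> supp (conv G p (emb a))"
    by (auto simp: in_keys_iff)
  moreover have "supp (conv G p (emb a)) \<subseteq> (\<lambda>g. g \<otimes>\<^bsub>G\<^esub> a) ` supp p"
  proof
    fix g assume "g \<in> supp (conv G p (emb a))"
    then obtain b where "b \<in> supp p" "(Poly_Mapping.lookup p b when b \<otimes>\<^bsub>G\<^esub> a = g) \<noteq> 0"
      unfolding in_keys_iff[of g] lookup by (rule sum.not_neutral_contains_not_neutral)
    then show "g \<in> (\<lambda>g. g \<otimes>\<^bsub>G\<^esub> a) ` supp p" by auto
  qed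
  ultimately show ?thesis by blast
qed

lemma finsum_group_algebra:
  fixes f :: "'i \<Rightarrow> 'g \<Rightarrow>\<^sub>0 'r::ring_1"
  assumes "group G" "finite I" "\<And>i. i \<in> I \<Longrightarrow> supp (f i) \<subseteq> carrier G"
  shows "(\<Oplus>\<^bsub>group_algebra G\<^esub>i\<in>I. f i) = (\<Sum>i\<in>I. f i)"
proof -
  interpret ring "group_algebra G :: ('g \<Rightarrow>\<^sub>0 'r) ring"
    using assms(1) by (rule ring_group_algebra)
  show ?thesis
    using assms(2,3)
  proof (induction I rule: finite_induct)
    case (insert i I)
    then show ?case
      using finsum_insert[of I i f] by (auto simp: Pi_iff)
  next
    case empty
    show ?case using finsum_empty[of f] by simp
  qed
qed

lemma poly_mapping_bit_eqI:
  fixes p q :: "'a \<Rightarrow>\<^sub>0 bit"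
  assumes "supp p = supp q"
  shows "p = q"
  by (rule poly_mapping_eqI) (metis assms bit_not_zero_iff in_keys_iff)

lemma supp_sum_emb:
  assumes "finite I" "inj_on f I"
  shows "supp (\<Sum>i\<in>I. emb (f i) :: 'g \<Rightarrow>\<^sub>0 'r::ring_1) = f ` I"
proof -
  have "(\<Sum>i\<in>I. emb (f i) :: 'g \<Rightarrow>\<^sub>0 'r) = (\<Sum>h\<in>f ` I. emb h)"
    using assms by (simp add: sum.reindex)
  then show ?thesis
    using assms by (auto simp: in_keys_iff lookup_sum lookup_single when_def split: if_splits)
qed

section \<open>Minimal annihilated elements\<close>

definition restrict_supp :: "'g set \<Rightarrow> ('g \<Rightarrow>\<^sub>0 'r::comm_monoid_add) \<Rightarrow> ('g \<Rightarrow>\<^sub>0 'r)" where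
  "restrict_supp H q = (\<Sum>h\<in>supp q \<inter> H. Poly_Mapping.single h (Poly_Mapping.lookup q h))"

lemma lookup_restrict_supp:
  "Poly_Mapping.lookup (restrict_supp H q) g = (if g \<in> H then Poly_Mapping.lookup q g else 0)"
  by (simp add: restrict_supp_def lookup_sum lookup_single when_def in_keys_iff)

lemma supp_restrict_supp: "supp (restrict_supp H q) = supp q \<inter> H"
  by (auto simp: in_keys_iff lookup_restrict_supp split: if_splits)

text \<open>
  Left multiplication by elements of \<open>H\<close> preserves each right coset \<open>H g\<close>, so a product \<open>p q\<close> with
  \<open>p\<close> supported in \<open>H\<close> is computed coset by coset; the restriction keeps only the coset \<open>H\<close>.
\<close>

lemma conv_restrict_eq_0:
  assumes "group G" "subgroup H G" "supp p \<subseteq> H" "supp q \<subseteq> carrier G" "conv G p q = 0"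
  shows "conv G p (restrict_supp H q) = 0"
proof (rule poly_mapping_eqI)
  fix g
  interpret group G by fact
  have H: "H \<subseteq> carrier G" using assms(2) by (rule subgroup.subset)
  have p: "supp p \<subseteq> carrier G" using assms(3) H by blast
  have r: "supp (restrict_supp H q) \<subseteq> carrier G"
    using assms(4) by (auto simp: supp_restrict_supp)
  show "Poly_Mapping.lookup (conv G p (restrict_supp H q)) g = Poly_Mapping.lookup 0 g"
  proof (cases "g \<in> carrier G")
    case True
    have mem: "inv\<^bsub>G\<^esub> a \<otimes>\<^bsub>G\<^esub> g \<in> H \<longleftrightarrow> g \<in> H" if "a \<in> supp p" for a
    proof -
      have a: "a \<in> H" "a \<in> carrier G" using that assms(3) H by auto
      have "g = a \<otimes>\<^bsub>G\<^esub> (inv\<^bsub>G\<^esub> a \<otimes>\<^bsub>G\<^esub> g)"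
        using a True by (simp flip: m_assoc)
      then show ?thesis
        using a(1) subgroup.m_closed[OF assms(2)] subgroup.m_inv_closed[OF assms(2)] by metis
    qed
    have "Poly_Mapping.lookup (conv G p (restrict_supp H q)) g =
        (\<Sum>a\<in>supp p. Poly_Mapping.lookup p a *
          (if g \<in> H then Poly_Mapping.lookup q (inv\<^bsub>G\<^esub> a \<otimes>\<^bsub>G\<^esub> g) else 0))"
      by (simp add: lookup_conv[OF assms(1) p r True] lookup_restrict_supp mem cong: sum.cong)
    also have "\<dots> = (if g \<in> H then Poly_Mapping.lookup (conv G p q) g else 0)"
      by (simp add: lookup_conv[OF assms(1) p assms(4) True])
    finally show ?thesis by (simp add: assms(5))
  next
    case False
    then show ?thesis
      using supp_conv[OF assms(1) p r] by (auto simp: in_keys_iff)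
  qed
qed

text \<open>
  The restriction of \<open>q\<close> to \<open>H\<close> is non-zero, since it keeps \<open>h\<close>, and competes with \<open>q\<close> in the minimality
  condition: it cannot have lost any element of the support.
\<close>

lemma minimal_annihilated_supp_subset:
  assumes "group G" "subgroup H G" "supp p \<subseteq> H" "supp q \<subseteq> carrier G" "conv G p q = 0"
    and "h \<in> supp q" "h \<in> H"
    and min: "\<And>r. supp r \<subseteq> carrier G \<Longrightarrow> r \<noteq> 0 \<Longrightarrow> conv G p r = 0 \<Longrightarrow> card (supp q) \<le> card (supp r)"
  shows "supp q \<subseteq> H"
proof -
  have "h \<in> supp (restrict_supp H q)" using assms by (simp add: supp_restrict_supp)
  then have "restrict_supp H q \<noteq> 0" by auto
  then have "card (supp q) \<le> card (supp q \<inter> H)"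
    using min[of "restrict_supp H q"] conv_restrict_eq_0[OF assms(1-5)] assms(4)
    by (auto simp: supp_restrict_supp)
  then have "supp q \<inter> H = supp q"
    by (intro card_seteq) auto
  then show ?thesis by blast
qed

section \<open>The recurrence\<close>

text \<open>
  The coefficient of \<open>(1 + x + x\<^sup>-\<^sup>1) q\<close> at \<open>x g\<close> and that of \<open>(1 + x + x\<^sup>2) q\<close> at \<open>x\<^sup>2 g\<close> are both
  the sum of the coefficients of \<open>q\<close> at \<open>g\<close>, \<open>x g\<close> and \<open>x\<^sup>2 g\<close>.
\<close>

lemma annihilated_by_trinomial:
  fixes G (structure) and q :: "'g \<Rightarrow>\<^sub>0 'r::ring_1"
  assumes "group G" "x \<in> carrier G" "supp q \<subseteq> carrier G" "g \<in> carrier G"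
    and "p = emb \<one> + emb x + emb (inv x) \<or> p = emb \<one> + emb x + emb (x [^] (2::nat))"
    and "conv G p q = 0"
  shows "Poly_Mapping.lookup q g + Poly_Mapping.lookup q (x \<otimes> g) +
    Poly_Mapping.lookup q (x [^] (2::nat) \<otimes> g) = 0"
proof -
  interpret group G by fact
  note [simp] = conv_add_left lookup_add lookup_conv_emb_left[OF assms(1) _ assms(3)]
  from assms(5) show ?thesis
  proof
    assume "p = emb \<one> + emb x + emb (inv x)"
    then have "Poly_Mapping.lookup (conv G (emb \<one> + emb x + emb (inv x)) q) (x \<otimes> g) = 0"
      using assms(6) by simp
    moreover have "inv x \<otimes> (x \<otimes> g) = g" "x \<otimes> (x \<otimes> g) = x [^] (2::nat) \<otimes> g"
      using assms(2,4) by (simp_all add: m_assoc[symmetric] numeral_2_eq_2)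
    ultimately show ?thesis
      using assms(2,4) by (simp add: add_ac)
  next
    assume "p = emb \<one> + emb x + emb (x [^] (2::nat))"
    then have "Poly_Mapping.lookup (conv G (emb \<one> + emb x + emb (x [^] (2::nat))) q)
        (x [^] (2::nat) \<otimes> g) = 0"
      using assms(6) by simp
    moreover have "inv x \<otimes> (x [^] (2::nat) \<otimes> g) = x \<otimes> g"
      "inv (x [^] (2::nat)) \<otimes> (x [^] (2::nat) \<otimes> g) = g"
      using assms(2,4)
      by (simp_all add: m_assoc[symmetric]) (simp add: m_assoc[symmetric] numeral_2_eq_2)
    ultimately show ?thesis
      using assms(2,4) by (simp add: add_ac)
  qed
qed

text \<open>
  Adding two consecutive instances of the recurrence cancels the two middle terms, which leaves
  \<open>c\<^sub>i + c\<^sub>i\<^sub>+\<^sub>3 = 0\<close>.  Each period contains an even number of ones, hence exactly one zero,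
  whose residue is \<open>r\<close>.
\<close>

lemma bit_fibonacci_pattern:
  fixes c :: "nat \<Rightarrow> bit"
  assumes rec: "\<And>i. c i + c (i + 1) + c (i + 2) = 0" and "c 0 = 1"
  obtains r where "r = 1 \<or> r = 2" "\<And>i. c i \<noteq> 0 \<longleftrightarrow> i mod 3 \<noteq> r"
proof -
  have step: "c (i + 3) = c i" for i
    using rec[of i] rec[of "i + 1"]
    by (cases "c i"; cases "c (i + 1)"; cases "c (i + 2)"; cases "c (i + 3)")
      (simp_all add: numeral_3_eq_3)
  have "c (j + 3 * m) = c j" for j m
  proof (induction m)
    case (Suc m)
    then show ?case using step[of "j + 3 * m"] by (simp add: add_ac)
  qed simp
  from this[of "i mod 3" "i div 3" for i] have mod3: "c i = c (i mod 3)" for i by simp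
  have "i mod 3 = 0 \<or> i mod 3 = 1 \<or> i mod 3 = 2" for i :: nat by arith
  moreover have "c 1 = 0 \<and> c 2 = 1 \<or> c 1 = 1 \<and> c 2 = 0"
    using rec[of 0] assms(2) by (cases "c 1"; cases "c 2") (simp_all add: numeral_2_eq_2)
  ultimately show thesis
    using that[of 1] that[of 2] mod3 assms(2)
    by (metis zero_neq_one)
qed

text \<open>
  At \<open>i = r\<close> the periodicity says that \<open>r + n\<close> is congruent to \<open>r\<close> modulo \<open>3\<close>.
\<close>

lemma period_of_mod3_pattern:
  fixes n r :: nat
  assumes "r < 3" and "\<And>i. (i + n) mod 3 = r \<longleftrightarrow> i mod 3 = r"
  shows "3 dvd n"
  using assms(2)[of r] assms(1) by (simp add: mod_eq_dvd_iff_nat dvd_eq_mod_eq_0) presburger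

lemma card_mod3_neq:
  assumes "r < (3::nat)"
  shows "card {i. i < 3 * m \<and> i mod 3 \<noteq> r} = 2 * m"
proof (induction m)
  case (Suc m)
  have "{i. i < 3 * Suc m \<and> i mod 3 \<noteq> r} =
      {i. i < 3 * m \<and> i mod 3 \<noteq> r} \<union> (\<lambda>j. 3 * m + j) ` ({0, 1, 2} - {r})"
  proof (intro Set.set_eqI iffI)
    fix i assume i: "i \<in> {i. i < 3 * Suc m \<and> i mod 3 \<noteq> r}"
    show "i \<in> {i. i < 3 * m \<and> i mod 3 \<noteq> r} \<union> (\<lambda>j. 3 * m + j) ` ({0, 1, 2} - {r})"
    proof (cases "i < 3 * m")
      case False
      then obtain j where j: "i = 3 * m + j" by (metis le_add_diff_inverse not_less)
      then have "j \<in> {0, 1, 2}" "j mod 3 = j" using i by auto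
      then have "j \<in> {0, 1, 2} - {r}" using i j by auto
      then show ?thesis using j by blast
    qed (use i in auto)
  qed (auto, presburger)
  moreover have "card ({i. i < 3 * m \<and> i mod 3 \<noteq> r} \<union> (\<lambda>j. 3 * m + j) ` ({0, 1, 2} - {r})) =
      card {i. i < 3 * m \<and> i mod 3 \<noteq> r} + card ((\<lambda>j. 3 * m + j) ` ({0, 1, 2} - {r}))"
    by (rule card_Un_disjoint) auto
  moreover have "card ((\<lambda>j. 3 * m + j) ` ({0, 1, 2} - {r})) = 2"
    using assms by (subst card_image) (auto simp: card_Diff_singleton_if)
  ultimately show ?case
    using Suc.IH by (simp only: mult_Suc_right add.commute)
qed simp

lemma step3_eq:
  fixes s :: "nat \<Rightarrow> nat"
  assumes "s 0 = 0" "s 1 = 1" "\<forall>i\<in>{2..k}. s i = s (i - 2) + 3" "i \<le> k"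
  shows "s i = 3 * (i div 2) + i mod 2"
  using assms(4)
proof (induction i rule: less_induct)
  case (less i)
  consider "i = 0" | "i = 1" | j where "i = j + 2"
    by (metis One_nat_def add_2_eq_Suc' not0_implies_Suc)
  then show ?case
  proof cases
    case 3
    then have "s i = s j + 3" using assms(3) less.prems by simp
    with less.IH[of j] less.prems 3 show ?thesis by simp
  qed (use assms in auto)
qed

text \<open>The numbers \<open>0, 1, 3, 4, 6, 7, \<dots>\<close>: the pair \<open>2 q, 2 q + 1\<close> is sent to \<open>3 q, 3 q + 1\<close>.\<close>

lemma image_step3:
  "(\<lambda>i. 3 * (i div 2) + i mod 2) ` {..<2 * m} = {i::nat. i < 3 * m \<and> i mod 3 \<noteq> 2}"
proof (intro Set.set_eqI iffI)
  fix i :: nat assume i: "i \<in> {i. i < 3 * m \<and> i mod 3 \<noteq> 2}"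
  define q t where "q = i div 3" and "t = i mod 3"
  have "i = 3 * q + t" "t < 2" using i by (auto simp: q_def t_def)
  then have "i = 3 * ((2 * q + t) div 2) + (2 * q + t) mod 2" "2 * q + t < 2 * m"
    using i by auto
  then show "i \<in> (\<lambda>i. 3 * (i div 2) + i mod 2) ` {..<2 * m}" by blast
qed auto

theorem theorem1p4:
  fixes G :: "('g, 'm) monoid_scheme" (structure)
    and x :: 'g
    and \<alpha> \<beta> \<beta>' :: "'g \<Rightarrow>\<^sub>0 bit"
    and k :: nat
    and s :: "nat \<Rightarrow> nat"
  assumes "group G"
    and "x \<in> carrier G"
    and "elt_order G x > 2"
    and "\<alpha> \<in> {emb \<one> \<oplus>\<^bsub>F2_algebra G\<^esub> emb x \<oplus>\<^bsub>F2_algebra G\<^esub> emb (inv x),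
              emb \<one> \<oplus>\<^bsub>F2_algebra G\<^esub> emb x \<oplus>\<^bsub>F2_algebra G\<^esub> emb (x [^] (2::nat))}"
    and "\<beta> \<in> carrier (F2_algebra G)"
    and "\<beta> \<noteq> \<zero>\<^bsub>F2_algebra G\<^esub>"
    and "\<alpha> \<otimes>\<^bsub>F2_algebra G\<^esub> \<beta> = \<zero>\<^bsub>F2_algebra G\<^esub>"
    and "\<one> \<in> supp \<beta>"
    and "\<forall>\<gamma>\<in>carrier (F2_algebra G).
           \<gamma> \<noteq> \<zero>\<^bsub>F2_algebra G\<^esub> \<and> \<alpha> \<otimes>\<^bsub>F2_algebra G\<^esub> \<gamma> = \<zero>\<^bsub>F2_algebra G\<^esub> \<longrightarrow>
           card (supp \<beta>) \<le> card (supp \<gamma>)"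
    and "k = card (supp \<beta>) - 1"
    and "s 0 = 0"
    and "s 1 = 1"
    and "\<forall>i\<in>{2..k}. s i = s (i - 2) + 3"
    and "\<beta>' = (\<Oplus>\<^bsub>F2_algebra G\<^esub>i\<in>{0..k}. emb (x [^] s i))"
  shows "\<beta> = \<beta>' \<or> \<beta> = \<beta>' \<otimes>\<^bsub>F2_algebra G\<^esub> emb (inv x)"
proof -
  interpret group G by fact
  let ?x = "\<lambda>i::nat. x [^] i"
  define n where "n = ord x"
  have \<beta>: "supp \<beta> \<subseteq> carrier G" and ann: "conv G \<alpha> \<beta> = 0"
    using assms(5,7) by simp_all
  have \<alpha>: "\<alpha> = emb \<one> + emb x + emb (inv x) \<or> \<alpha> = emb \<one> + emb x + emb (x [^] (2::nat))"
    using assms(4) by simp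
  \<comment> \<open>Coefficients along natural powers of \<open>x\<close> suffice: once the order is known to be finite, they
    exhaust the cyclic group.\<close>
  define c where "c i = Poly_Mapping.lookup \<beta> (?x i)" for i
  have "c i + c (i + 1) + c (i + 2) = 0" for i
    using annihilated_by_trinomial[OF assms(1,2) \<beta> _ \<alpha> ann, of "?x i"] assms(2)
    by (simp add: c_def nat_pow_mult nat_pow_Suc2[symmetric] add.commute)
  moreover have "c 0 = 1"
    using assms(8) by (simp add: c_def in_keys_iff)
  ultimately obtain r where r: "r = 1 \<or> r = 2" and cr: "\<And>i. c i \<noteq> 0 \<longleftrightarrow> i mod 3 \<noteq> r"
    using bit_fibonacci_pattern[of c] by metis

  have pow_eq: "?x i = ?x j \<longleftrightarrow> int n dvd int j - int i" for i j
    using int_pow_eq[OF assms(2), of "int i" "int j"] by (simp add: n_def int_pow_int)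
  \<comment> \<open>If \<open>x\<close> had infinite order, \<open>\<beta>\<close> would be \<open>1\<close> at each of the distinct elements \<open>x [^] (3 * i)\<close>.\<close>
  have n: "n > 0"
  proof (rule ccontr)
    assume "\<not> n > 0"
    then have "infinite (range (\<lambda>i. ?x (3 * i)))"
      by (intro range_inj_infinite) (simp add: pow_eq inj_def)
    moreover have "range (\<lambda>i. ?x (3 * i)) \<subseteq> supp \<beta>"
      using cr r by (auto simp: c_def in_keys_iff)
    ultimately show False
      using finite_subset finite_keys by blast
  qed
  have xn: "?x (i + n) = ?x i" for i
    by (simp add: pow_eq)
  then have "c (i + n) = c i" for i by (simp add: c_def)
  then have "3 dvd n"
    using cr r by (intro period_of_mod3_pattern[of r]) (auto, metis+)
  then obtain m where m: "n = 3 * m" by blast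

  have powers: "generate G {x} = range ?x"
    using generate_pow_nat[OF assms(2)] n by (auto simp: n_def)
  have sub: "subgroup (generate G {x}) G"
    using assms(2) by (intro generate_is_subgroup) auto
  have "supp \<beta> \<subseteq> range ?x"
    unfolding powers[symmetric]
  proof (rule minimal_annihilated_supp_subset[OF assms(1) sub _ \<beta> ann assms(8)])
    have "\<one> \<in> generate G {x}" "x \<in> generate G {x}" "inv x \<in> generate G {x}"
      by (simp_all add: generate.intros)
    moreover have "x [^] (2::nat) \<in> generate G {x}"
      unfolding powers by blast
    ultimately show "supp \<alpha> \<subseteq> generate G {x}"
      using \<alpha> by (elim disjE; simp; intro supp_add_subset; simp)
    show "\<one> \<in> generate G {x}" by (rule generate.one)
  qed (use assms(9) in auto)
  then have supp\<beta>: "supp \<beta> = ?x ` {i. i mod 3 \<noteq> r}"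
    using cr by (auto simp: c_def in_keys_iff)
  \<comment> \<open>As \<open>3\<close> divides \<open>n\<close>, reducing exponents modulo \<open>n\<close> preserves their residues modulo \<open>3\<close>.\<close>
  have reduce: "?x ` {i. i mod 3 \<noteq> t} = ?x ` {i. i < 3 * m \<and> i mod 3 \<noteq> t}" for t
  proof -
    have "?x i = ?x (i mod n)" for i
      by (simp add: pow_eq zmod_int flip: mod_eq_dvd_iff)
    moreover have "i mod n mod 3 = i mod 3" "i mod n < 3 * m" for i
      using n m by (simp_all add: mod_mod_cancel)
    ultimately show ?thesis by (fastforce simp: image_iff)
  qed
  have inj: "inj_on ?x {i. i < 3 * m}"
    by (auto simp: inj_on_def pow_eq simp flip: m mod_eq_dvd_iff zmod_int)
  have "card (supp \<beta>) = 2 * m"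
    unfolding supp\<beta> reduce using card_mod3_neq[of r m] r
    by (subst card_image) (auto intro: inj_on_subset[OF inj])
  then have k: "{0..k} = {..<2 * m}"
    using assms(10) n m by auto

  have s_image: "s ` {0..k} = {i. i < 3 * m \<and> i mod 3 \<noteq> 2}"
    unfolding image_step3[symmetric] k[symmetric]
    using step3_eq[OF assms(11-13)] by (intro image_cong) auto
  then have inj_s: "inj_on s {0..k}"
    using card_mod3_neq[of 2 m] k by (intro eq_card_imp_inj_on) simp_all
  have "\<beta>' = (\<Sum>i\<in>{0..k}. emb (?x (s i)))"
    using assms(1,2,14) by (simp add: finsum_group_algebra)
  moreover have "inj_on (\<lambda>i. ?x (s i)) {0..k}"
    using comp_inj_on[OF inj_s inj_on_subset[OF inj], unfolded comp_def] s_image by auto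
  ultimately have "supp \<beta>' = (\<lambda>i. ?x (s i)) ` {0..k}"
    by (simp add: supp_sum_emb)
  then have supp\<beta>': "supp \<beta>' = ?x ` {i. i mod 3 \<noteq> 2}"
    unfolding reduce s_image[symmetric] by (simp add: image_image)

  from r show ?thesis
  proof
    assume "r = 2"
    then have "\<beta> = \<beta>'"
      using supp\<beta> supp\<beta>' by (intro poly_mapping_bit_eqI) simp
    then show ?thesis ..
  next
    assume "r = 1"
    \<comment> \<open>The exponent \<open>i - 1\<close> is represented by the natural number \<open>i + n - 1\<close>, which has the same
      residue modulo \<open>3\<close> because \<open>3\<close> divides \<open>n\<close>.\<close>
    have shift: "?x (i + n - 1) = ?x i \<otimes> inv x" for i
    proof -
      have "?x (i + n - 1) \<otimes> x = ?x i"
        using n xn[of i] by (simp flip: nat_pow_Suc)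
      then show ?thesis
        using assms(2) by (metis inv_solve_right nat_pow_closed)
    qed
    have "supp \<beta>' \<subseteq> carrier G"
      using assms(2) by (auto simp: supp\<beta>')
    then have "supp (conv G \<beta>' (emb (inv x))) = (\<lambda>i. ?x (i + n - 1)) ` {i. i mod 3 \<noteq> 2}"
      unfolding shift using assms(1,2) by (simp add: supp_conv_emb_right supp\<beta>' image_image)
    also have "\<dots> = ?x ` {i. i mod 3 \<noteq> 1}"
    proof (intro Set.set_eqI iffI)
      fix g assume "g \<in> (\<lambda>i. ?x (i + n - 1)) ` {i. i mod 3 \<noteq> 2}"
      then obtain i where "g = ?x (i + n - 1)" "i mod 3 \<noteq> 2" by auto
      moreover have "i + n - 1 = i + 2 + 3 * (m - 1)" using n m by simp
      then have "(i + n - 1) mod 3 = (i + 2) mod 3" by (simp only: mod_mult_self2)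
      moreover have "(i + 2) mod 3 \<noteq> 1" using \<open>i mod 3 \<noteq> 2\<close> by presburger
      ultimately show "g \<in> ?x ` {i. i mod 3 \<noteq> 1}" by simp
    next
      fix g assume "g \<in> ?x ` {i. i mod 3 \<noteq> 1}"
      then obtain i where i: "g = ?x i" "i mod 3 \<noteq> 1" by blast
      have "g = ?x (Suc i + n - 1)" using i(1) xn[of i] by simp
      moreover have "Suc i mod 3 \<noteq> 2" using i(2) by presburger
      ultimately show "g \<in> (\<lambda>i. ?x (i + n - 1)) ` {i. i mod 3 \<noteq> 2}" by blast
    qed
    finally have "\<beta> = conv G \<beta>' (emb (inv x))"
      using supp\<beta> \<open>r = 1\<close> by (intro poly_mapping_bit_eqI) simp
    then show ?thesis by simp
  qed
qed

end
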